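(* Let $M\ge 1$, let $0<x_1<x_2<\cdots<x_M$ be real numbers and let $a_1,\dots,a_M$ be real numbers, not all zero. Let $$X(x,y)=\sum_{j=1}^M\frac{a_j(x-x_j)}{((x-x_j)^2+y^2)^{3/2}},\qquad Y(x,y)=\sum_{j=1}^M\frac{a_jy}{((x-x_j)^2+y^2)^{3/2}}$$ for $(x,y)\in\mathbb{R}^2\setminus\{(x_1,0),\dots,(x_M,0)\}$. Then no line, except possibly the lines $y=x$ and $y=-x$, is an asymptotic direction both for the zero set $\{X=0\}$ and for the zero set $\{Y=0\}$.
   Context: Asymptotic directions: for $\alpha\in\mathbb{R}$, the line $y=\alpha x$ is an asymptotic direction for a set $A\subset\mathbb{R}^2$ if there are points $(p_m,q_m)\in A$, $m=1,2,\dots$, with $|p_m|\to\infty$ and $\lim_{m\to\infty}q_m/p_m=\alpha$. The $y$-axis is an asymptotic direction for $A$ if there are points $(p_m,q_m)\in A$ with $|q_m|\to\infty$ and $\lim_{m\to\infty}p_m/q_m=0$. *)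

theory Defs
  imports "HOL-Analysis.Analysis"
begin

definition slope_line :: "real \<Rightarrow> (real \<times> real) set" where
  "slope_line \<alpha> = {(u, v). v = \<alpha> * u}"

definition y_axis :: "(real \<times> real) set" where
  "y_axis = {(u, v). u = 0}"

text \<open>The quotients may have denominator zero for finitely many indices only,
  so the convention that division by zero is zero does not affect the limits.
  The relation holds only if the first argument is a line through the origin.\<close>

definition asymptotic_direction :: "(real \<times> real) set \<Rightarrow> (real \<times> real) set \<Rightarrow> bool" where
  "asymptotic_direction L A \<longleftrightarrow>
     (\<exists>\<alpha>. L = slope_line \<alpha> \<and>
        (\<exists>p q :: nat \<Rightarrow> real.
            (\<forall>m. (p m, q m) \<in> A) \<and>
            filterlim (\<lambda>m. \<bar>p m\<bar>) at_top sequentially \<and>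
            (\<lambda>m. q m / p m) \<longlonglongrightarrow> \<alpha>)) \<or>
     (L = y_axis \<and>
        (\<exists>p q :: nat \<Rightarrow> real.
            (\<forall>m. (p m, q m) \<in> A) \<and>
            filterlim (\<lambda>m. \<bar>q m\<bar>) at_top sequentially \<and>
            (\<lambda>m. p m / q m) \<longlonglongrightarrow> 0))"

definition field_domain :: "nat \<Rightarrow> (nat \<Rightarrow> real) \<Rightarrow> (real \<times> real) set" where
  "field_domain M x = UNIV - {(x j, 0) | j. j \<in> {1..M}}"

definition field_X :: "nat \<Rightarrow> (nat \<Rightarrow> real) \<Rightarrow> (nat \<Rightarrow> real) \<Rightarrow> real \<Rightarrow> real \<Rightarrow> real" where
  "field_X M a x u v =
     (\<Sum>j = 1..M. a j * (u - x j) / ((u - x j)\<^sup>2 + v\<^sup>2) powr (3 / 2))"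

definition field_Y :: "nat \<Rightarrow> (nat \<Rightarrow> real) \<Rightarrow> (nat \<Rightarrow> real) \<Rightarrow> real \<Rightarrow> real \<Rightarrow> real" where
  "field_Y M a x u v =
     (\<Sum>j = 1..M. a j * v / ((u - x j)\<^sup>2 + v\<^sup>2) powr (3 / 2))"

definition zero_set_X :: "nat \<Rightarrow> (nat \<Rightarrow> real) \<Rightarrow> (nat \<Rightarrow> real) \<Rightarrow> (real \<times> real) set" where
  "zero_set_X M a x = {(u, v) \<in> field_domain M x. field_X M a x u v = 0}"

definition zero_set_Y :: "nat \<Rightarrow> (nat \<Rightarrow> real) \<Rightarrow> (nat \<Rightarrow> real) \<Rightarrow> (real \<times> real) set" where
  "zero_set_Y M a x = {(u, v) \<in> field_domain M x. field_Y M a x u v = 0}"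

end

theory Submission
  imports Defs "HOL-Computational_Algebra.Polynomial"
begin

text \<open>
  The pair \<open>(X, Y)\<close> is minus the gradient of the potential of point charges \<open>a\<^sub>j\<close> at the
  points \<open>(x\<^sub>j, 0)\<close>, and far away it is governed by the first nonzero multipole.  Let
  \<open>\<mu>\<^sub>k = \<Sum>\<^sub>j a\<^sub>j x\<^sub>j\<^sup>k\<close>; since the \<open>x\<^sub>j\<close> are distinct and some \<open>a\<^sub>j\<close> is nonzero, there is a least
  \<open>n\<close> with \<open>\<mu>\<^sub>n \<noteq> 0\<close> (\<open>some_moment_nonzero\<close>).

  Write a far point as \<open>\<rho> (b, d)\<close> with \<open>\<bar>\<rho>\<bar>\<close> large and \<open>(b, d)\<close> close to a fixed direction
  vector, and put \<open>A = b\<^sup>2 + d\<^sup>2\<close>.  Up to a factor depending on \<open>\<rho>\<close> alone, the charge at \<open>x\<^sub>j\<close>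
  contributes \<open>a\<^sub>j (b - s) (A - 2 b s + s\<^sup>2)\<^bsup>-3/2\<^esup>\<close> to \<open>X\<close> and \<open>a\<^sub>j d (A - 2 b s + s\<^sup>2)\<^bsup>-3/2\<^esup>\<close>
  to \<open>Y\<close>, where \<open>s = x\<^sub>j / \<rho>\<close>.  Let \<open>G\<^sub>k\<close> be the coefficients of
  \<open>A\<^bsup>3/2\<^esup> (A - 2 b s + s\<^sup>2)\<^bsup>-3/2\<^esup>\<close> as a power series in \<open>s\<close>
  (\<open>gegenbauer_generating_function\<close>).  With the same normalisation, the series for
  \<open>X\<close> has the coefficients \<open>H\<^sub>k = b G\<^sub>k - G\<^sub>k\<^sub>-\<^sub>1\<close>.  Summing over the charges replaces \<open>s\<^sup>k\<close> by \<open>\<mu>\<^sub>k \<rho>\<^bsup>-k\<^esup>\<close>, so the term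
  with index \<open>n\<close> dominates, uniformly in the direction.  Hence zeros of \<open>X\<close> can escape only
  along directions with \<open>H\<^sub>n = 0\<close>, and zeros of \<open>Y\<close> only along the \<open>x\<close>-axis or directions
  with \<open>G\<^sub>n = 0\<close> (\<open>zero_set_X_direction\<close>, \<open>zero_set_Y_direction\<close>).

  The two conditions exclude each other.  If \<open>G\<^sub>n = H\<^sub>n = 0\<close>, then \<open>G\<^sub>n\<^sub>-\<^sub>1 = 0\<close> as well, and the
  three-term recurrence of the \<open>G\<^sub>k\<close>, read backwards, gives \<open>G\<^sub>0 = 0\<close>, although \<open>G\<^sub>0 = 1\<close>
  (\<open>no_common_zero\<close>).  There remains the \<open>x\<close>-axis, on which \<open>Y\<close> vanishes identically; it is
  not an asymptotic direction of the zero set of \<open>X\<close>, because \<open>H\<^sub>n = n + 1\<close> there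
  (\<open>legendre_coeff_on_axis\<close>).
\<close>

section \<open>Moments and the leading term\<close>

text \<open>If all moments vanished, so would \<open>\<Sum>\<^sub>j a\<^sub>j p(x\<^sub>j)\<close> for every polynomial \<open>p\<close>.  The polynomial
  with roots at all nodes but \<open>x\<^sub>i\<close> isolates the weight \<open>a\<^sub>i\<close>.\<close>

lemma some_moment_nonzero:
  fixes a x :: "'i \<Rightarrow> real"
  assumes fin: "finite J" and inj: "inj_on x J" and i: "i \<in> J" "a i \<noteq> 0"
  shows "\<exists>k. (\<Sum>j\<in>J. a j * x j ^ k) \<noteq> 0"
proof (rule ccontr)
  assume "\<not> ?thesis"
  then have zero: "(\<Sum>j\<in>J. a j * x j ^ k) = 0" for k by blast
  have combination: "(\<Sum>j\<in>J. a j * poly p (x j)) = 0" for p :: "real poly"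
  proof -
    have "(\<Sum>j\<in>J. a j * poly p (x j))
        = (\<Sum>j\<in>J. \<Sum>k\<le>degree p. coeff p k * (a j * x j ^ k))"
      by (simp add: poly_altdef sum_distrib_left mult_ac)
    also have "\<dots> = (\<Sum>k\<le>degree p. coeff p k * (\<Sum>j\<in>J. a j * x j ^ k))"
      by (subst sum.swap) (simp add: sum_distrib_left)
    finally show ?thesis by (simp add: zero)
  qed
  define p where "p = (\<Prod>l\<in>J - {i}. [:- x l, 1:])"
  have "poly p (x j) = 0" if "j \<in> J - {i}" for j
    using that fin by (auto simp: p_def poly_prod)
  then have "(\<Sum>j\<in>J. a j * poly p (x j)) = a i * poly p (x i)"
    using fin i by (subst sum.remove[of _ i]) auto
  moreover have "poly p (x i) \<noteq> 0"
    using fin i inj by (auto simp: p_def poly_prod inj_on_def)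
  ultimately show False using combination[of p] i by simp
qed

lemma power_series_tail_bound:
  fixes g :: "nat \<Rightarrow> real"
  assumes bound: "\<And>k. \<bar>g k\<bar> \<le> C * K ^ k" and K: "K \<ge> 0" and s: "K * \<bar>s\<bar> \<le> 1 / 2"
  shows "\<bar>(\<Sum>k. g k * s ^ k) - (\<Sum>k<N. g k * s ^ k)\<bar> \<le> 2 * C * (K * \<bar>s\<bar>) ^ N"
proof -
  define t where "t = K * \<bar>s\<bar>"
  have t: "0 \<le> t" "t \<le> 1 / 2" using K s by (auto simp: t_def)
  have C: "C \<ge> 0" using bound[of 0] by simp
  have term_le: "norm (g k * s ^ k) \<le> C * t ^ k" for k
    using mult_right_mono[OF bound[of k], of "\<bar>s\<bar> ^ k"]
    by (simp add: t_def abs_mult power_abs power_mult_distrib mult_ac)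
  have geo: "(\<lambda>k. C * t ^ (k + N)) sums (C * t ^ N * (1 / (1 - t)))"
    using sums_mult[OF geometric_sums[of t], of "C * t ^ N"] t
    by (simp add: power_add mult_ac)
  have "summable (\<lambda>k. C * t ^ k)"
    using t by (intro summable_mult summable_geometric) simp
  then have summ: "summable (\<lambda>k. g k * s ^ k)"
    by (rule summable_comparison_test'[where N = 0]) (rule term_le)
  have "(\<Sum>k. g k * s ^ k) - (\<Sum>k<N. g k * s ^ k) = (\<Sum>k. g (k + N) * s ^ (k + N))"
    using suminf_minus_initial_segment[OF summ, of N] by simp
  also have "\<bar>\<dots>\<bar> \<le> (\<Sum>k. C * t ^ (k + N))"
    unfolding real_norm_def[symmetric]
    by (rule norm_suminf_le[OF term_le sums_summable[OF geo]])
  also have "\<dots> = C * t ^ N * (1 / (1 - t))" using geo by (rule sums_unique[symmetric])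
  also have "\<dots> \<le> C * t ^ N * 2"
    using t C by (intro mult_left_mono) (auto simp: field_simps)
  finally show ?thesis by (simp add: t_def mult_ac)
qed

text \<open>The multipole argument.  Expanding \<open>\<Sum>\<^sub>j a\<^sub>j f\<^sub>m(h\<^sub>m x\<^sub>j)\<close>, where \<open>f\<^sub>m\<close> is the power series with
  coefficients \<open>g\<^sub>m\<close>, gives \<open>\<mu>\<^sub>n g\<^sub>m(n) h\<^sub>m\<^sup>n\<close> plus an error of order \<open>h\<^sub>m\<^bsup>n+1\<^esup>\<close>.  The coefficients
  vary with \<open>m\<close>, so it is the common geometric bound that makes the error uniform.\<close>

lemma leading_coefficient_vanishes:
  fixes g :: "nat \<Rightarrow> nat \<Rightarrow> real" and a x :: "'i \<Rightarrow> real"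
  assumes fin: "finite J"
    and h: "h \<longlonglongrightarrow> 0" "eventually (\<lambda>m. h m \<noteq> 0) sequentially"
    and K: "K \<ge> 0"
    and bound: "eventually (\<lambda>m. \<forall>k. \<bar>g m k\<bar> \<le> C * K ^ k) sequentially"
    and vanish: "eventually (\<lambda>m. (\<Sum>j\<in>J. a j * (\<Sum>k. g m k * (h m * x j) ^ k)) = 0) sequentially"
    and low: "\<And>k. k < n \<Longrightarrow> (\<Sum>j\<in>J. a j * x j ^ k) = 0"
    and top: "(\<Sum>j\<in>J. a j * x j ^ n) \<noteq> 0"
    and lim: "(\<lambda>m. g m n) \<longlonglongrightarrow> l"
  shows "l = 0"
proof -
  define \<mu> where "\<mu> = (\<Sum>j\<in>J. a j * x j ^ n)"
  define D where "D = (\<Sum>j\<in>J. \<bar>a j\<bar> * (2 * C * (K * \<bar>x j\<bar>) ^ Suc n))"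
  have small: "eventually (\<lambda>m. \<forall>j\<in>J. K * \<bar>h m * x j\<bar> \<le> 1 / 2) sequentially"
  proof (intro eventually_ball_finite fin ballI)
    fix j
    have "(\<lambda>m. K * \<bar>h m * x j\<bar>) \<longlonglongrightarrow> K * \<bar>0 * x j\<bar>"
      by (intro tendsto_intros h)
    then have "eventually (\<lambda>m. K * \<bar>h m * x j\<bar> < 1 / 2) sequentially"
      by (rule order_tendstoD) simp
    then show "eventually (\<lambda>m. K * \<bar>h m * x j\<bar> \<le> 1 / 2) sequentially"
      by eventually_elim simp
  qed
  have est: "eventually (\<lambda>m. norm (\<mu> * g m n) \<le> D * \<bar>h m\<bar>) sequentially"
    using h(2) bound vanish small
  proof eventually_elim
    case (elim m)
    let ?s = "\<lambda>j. h m * x j"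
    let ?S = "\<lambda>j. \<Sum>k. g m k * ?s j ^ k"
    let ?T = "\<lambda>j. \<Sum>k<Suc n. g m k * ?s j ^ k"
    have "(\<Sum>j\<in>J. a j * ?T j) = (\<Sum>k<Suc n. g m k * h m ^ k * (\<Sum>j\<in>J. a j * x j ^ k))"
      by (simp only: sum_distrib_left, subst sum.swap)
        (simp add: power_mult_distrib mult_ac)
    also have "\<dots> = g m n * h m ^ n * \<mu>"
      by (simp add: low \<mu>_def)
    finally have main: "(\<Sum>j\<in>J. a j * ?T j) = g m n * h m ^ n * \<mu>" .
    have "\<bar>g m n * h m ^ n * \<mu>\<bar> = \<bar>\<Sum>j\<in>J. a j * (?S j - ?T j)\<bar>"
      using elim(3) main by (simp add: right_diff_distrib sum_subtractf del: sum.lessThan_Suc)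
    also have "\<dots> \<le> (\<Sum>j\<in>J. \<bar>a j\<bar> * (2 * C * (K * \<bar>?s j\<bar>) ^ Suc n))"
    proof (rule order_trans[OF sum_abs sum_mono])
      fix j assume "j \<in> J"
      then have "\<bar>?S j - ?T j\<bar> \<le> 2 * C * (K * \<bar>?s j\<bar>) ^ Suc n"
        using elim by (intro power_series_tail_bound K) auto
      then show "\<bar>a j * (?S j - ?T j)\<bar> \<le> \<bar>a j\<bar> * (2 * C * (K * \<bar>?s j\<bar>) ^ Suc n)"
        unfolding abs_mult by (rule mult_left_mono) simp
    qed
    also have "\<dots> = D * \<bar>h m\<bar> * \<bar>h m\<bar> ^ n"
      unfolding D_def sum_distrib_right
      by (intro sum.cong refl) (simp add: abs_mult power_mult_distrib mult_ac)
    finally have "\<bar>\<mu> * g m n\<bar> * \<bar>h m\<bar> ^ n \<le> D * \<bar>h m\<bar> * \<bar>h m\<bar> ^ n"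
      by (simp add: abs_mult power_abs mult_ac)
    then show ?case using elim(1) by (auto simp: mult_le_cancel_right)
  qed
  have "(\<lambda>m. D * \<bar>h m\<bar>) \<longlonglongrightarrow> D * \<bar>0\<bar>" by (intro tendsto_intros h)
  then have "(\<lambda>m. \<mu> * g m n) \<longlonglongrightarrow> 0"
    using est by (intro Lim_null_comparison[of "\<lambda>m. \<mu> * g m n"]) auto
  moreover have "(\<lambda>m. \<mu> * g m n) \<longlonglongrightarrow> \<mu> * l" by (intro tendsto_intros lim)
  ultimately have "\<mu> * l = 0" by (rule LIMSEQ_unique[rotated])
  then show ?thesis using top by (simp add: \<mu>_def)
qed

section \<open>Expansion of the inverse cube of the distance\<close>

text \<open>With \<open>C\<^sub>k\<close> the Gegenbauer polynomial of parameter \<open>3/2\<close> (the derivative of the Legendre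
  polynomial \<open>P\<^sub>k\<^sub>+\<^sub>1\<close>), this is \<open>A\<^bsup>-k/2\<^esup> C\<^sub>k(b / \<surd>A)\<close> for \<open>A > 0\<close>.  Leaving \<open>A\<close> free avoids
  normalising direction vectors: a line of slope \<open>\<alpha>\<close> is represented by \<open>(1, \<alpha>)\<close>, the
  \<open>y\<close>-axis by \<open>(0, 1)\<close>.\<close>

fun gegenbauer_coeff :: "real \<Rightarrow> real \<Rightarrow> nat \<Rightarrow> real" where
  "gegenbauer_coeff A b 0 = 1"
| "gegenbauer_coeff A b (Suc 0) = 3 * b / A"
| "gegenbauer_coeff A b (Suc (Suc k)) =
     ((2 * real k + 5) * b * gegenbauer_coeff A b (Suc k)
       - (real k + 3) * gegenbauer_coeff A b k) / ((real k + 2) * A)"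

text \<open>For \<open>A = 1\<close> this is \<open>(k + 1) P\<^sub>k\<^sub>+\<^sub>1(b)\<close>, the coefficient of \<open>s\<^sup>k\<close> in the \<open>s\<close>-derivative of
  the generating function \<open>(1 - 2 b s + s\<^sup>2)\<^bsup>-1/2\<^esup>\<close> of the Legendre polynomials.\<close>

definition legendre_coeff :: "real \<Rightarrow> real \<Rightarrow> nat \<Rightarrow> real" where
  "legendre_coeff A b k =
     b * gegenbauer_coeff A b k - (if k = 0 then 0 else gegenbauer_coeff A b (k - 1))"

text \<open>In the recurrence the factors \<open>(2k + 5)/(k + 2)\<close> and \<open>(k + 3)/(k + 2)\<close> are at most \<open>5/2\<close>
  and \<open>3/2\<close>, and \<open>5/2 \<cdot> 4 + 3/2 \<le> 4\<^sup>2\<close>.\<close>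

lemma gegenbauer_coeff_bound:
  assumes A: "A \<ge> 1" and b: "\<bar>b\<bar> \<le> 1"
  shows "\<bar>gegenbauer_coeff A b k\<bar> \<le> 4 ^ k"
proof (induction k rule: induct_nat_012)
  case 1
  have "\<bar>3 * b / A\<bar> = 3 * \<bar>b\<bar> / A" using A by (simp add: abs_mult)
  also have "\<dots> \<le> 3" using A b by (simp add: field_simps)
  finally show ?case by simp
next
  case (ge2 k)
  let ?G = "gegenbauer_coeff A b"
  have "\<bar>(2 * real k + 5) * b * ?G (Suc k) - (real k + 3) * ?G k\<bar>
      \<le> (2 * real k + 5) * (\<bar>b\<bar> * \<bar>?G (Suc k)\<bar>) + (real k + 3) * \<bar>?G k\<bar>"
    by (rule order_trans[OF abs_triangle_ineq4]) (simp add: abs_mult)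
  also have "\<dots> \<le> (2 * real k + 5) * (1 * 4 ^ Suc k) + (real k + 3) * 4 ^ k"
    using ge2 b by (intro add_mono mult_left_mono mult_mono) auto
  also have "\<dots> \<le> (4 ^ Suc (Suc k) * (real k + 2)) * 1"
    by (simp add: algebra_simps)
  also have "\<dots> \<le> (4 ^ Suc (Suc k) * (real k + 2)) * A"
    using A by (intro mult_left_mono) auto
  finally have *: "\<bar>(2 * real k + 5) * b * ?G (Suc k) - (real k + 3) * ?G k\<bar>
     \<le> 4 ^ Suc (Suc k) * ((real k + 2) * A)" by (simp add: mult_ac)
  have "(real k + 2) * A > 0" using A by simp
  then show ?case using * by (simp add: divide_le_eq abs_divide del: power_Suc)
qed simp

lemma legendre_coeff_bound:
  assumes A: "A \<ge> 1" and b: "\<bar>b\<bar> \<le> 1"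
  shows "\<bar>legendre_coeff A b k\<bar> \<le> 2 * 4 ^ k"
proof -
  have 1: "\<bar>b * gegenbauer_coeff A b k\<bar> \<le> 1 * 4 ^ k"
    unfolding abs_mult using gegenbauer_coeff_bound[OF A b] b by (intro mult_mono) auto
  have "\<bar>gegenbauer_coeff A b (k - 1)\<bar> \<le> 4 ^ (k - 1)"
    by (rule gegenbauer_coeff_bound[OF A b])
  also have "\<dots> \<le> 4 ^ k" by (intro power_increasing) auto
  finally show ?thesis using 1 unfolding legendre_coeff_def by auto
qed

lemma sums_shift_power:
  fixes c :: "nat \<Rightarrow> real"
  assumes "(\<lambda>k. c k * s ^ k) sums v"
  shows "(\<lambda>k. (if k = 0 then 0 else c (k - 1)) * s ^ k) sums (s * v)"
proof -
  have "(\<lambda>k. (if Suc k = 0 then 0 else c (Suc k - 1)) * s ^ Suc k) sums (s * v)"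
    using sums_mult[OF assms, of s] by (simp add: mult_ac)
  from sums_Suc[OF this] show ?thesis by simp
qed

lemma gegenbauer_summable:
  assumes "A \<ge> 1" "\<bar>b\<bar> \<le> 1" "\<bar>s\<bar> < 1 / 4"
  shows "summable (\<lambda>k. gegenbauer_coeff A b k * s ^ k)"
proof (rule summable_comparison_test'[where N = 0])
  show "summable (\<lambda>k. (4 * \<bar>s\<bar>) ^ k)"
    using assms by (intro summable_geometric) simp
  show "norm (gegenbauer_coeff A b k * s ^ k) \<le> (4 * \<bar>s\<bar>) ^ k" for k
    using mult_right_mono[OF gegenbauer_coeff_bound[OF assms(1,2)], of "\<bar>s\<bar> ^ k" k]
    by (simp add: abs_mult power_abs power_mult_distrib)
qed

lemma quadratic_pos:
  fixes A b s :: real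
  assumes "A \<ge> 1" "\<bar>b\<bar> \<le> 1" "\<bar>s\<bar> < 1 / 4"
  shows "A - 2 * b * s + s\<^sup>2 > 0"
proof -
  have "\<bar>b * s\<bar> \<le> 1 * (1 / 4)"
    unfolding abs_mult using assms by (intro mult_mono) auto
  then have "b * s \<le> 1 / 4" by linarith
  then have "2 * b * s \<le> 1 / 2" by simp
  then show ?thesis using assms(1) zero_le_power2[of s] by linarith
qed

text \<open>With \<open>Q(s) = A - 2 b s + s\<^sup>2\<close>, the recurrence says that the sum \<open>S\<close> of the series solves
  \<open>Q S' = 3 (b - s) S\<close>.  Since \<open>Q' = 2 (s - b)\<close>, this makes \<open>S Q\<^bsup>3/2\<^esup>\<close> constant, and its value
  at \<open>0\<close> is \<open>A\<^bsup>3/2\<^esup>\<close>.\<close>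

lemma gegenbauer_generating_function:
  assumes A: "A \<ge> 1" and b: "\<bar>b\<bar> \<le> 1" and s: "\<bar>s\<bar> < 1 / 4"
  shows "(\<lambda>k. gegenbauer_coeff A b k * s ^ k) sums
           (A powr (3 / 2) / (A - 2 * b * s + s\<^sup>2) powr (3 / 2))"
proof -
  define c where "c = gegenbauer_coeff A b"
  define S where "S = (\<lambda>s. \<Sum>k. c k * s ^ k)"
  define S' where "S' = (\<lambda>s. \<Sum>k. diffs c k * s ^ k)"
  define Q where "Q = (\<lambda>s. A - 2 * b * s + s\<^sup>2)"
  have summ: "summable (\<lambda>k. c k * t ^ k)" if "\<bar>t\<bar> < 1 / 4" for t
    using gegenbauer_summable[OF A b that] by (simp add: c_def)
  have deriv: "(S has_real_derivative S' t) (at t)" if "\<bar>t\<bar> < 1 / 4" for t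
    unfolding S_def S'_def using that
    by (intro termdiffs_strong'[where K = "1 / 4"] summ) auto
  have ode: "Q t * S' t = 3 * (b - t) * S t" if t: "\<bar>t\<bar> < 1 / 4" for t
  proof -
    have 0: "(\<lambda>k. c k * t ^ k) sums S t"
      unfolding S_def using summ[OF t] by (rule summable_sums)
    have "summable (\<lambda>k. diffs c k * t ^ k)"
      using t by (intro termdiff_converges[where K = "1 / 4"] summ) auto
    then have 1: "(\<lambda>k. diffs c k * t ^ k) sums S' t"
      unfolding S'_def by (rule summable_sums)
    note 2 = sums_shift_power[OF 1]
    note 3 = sums_shift_power[OF 2]
    note 4 = sums_shift_power[OF 0]
    \<comment> \<open>the coefficients of \<open>t S'\<close>, \<open>t\<^sup>2 S'\<close> and \<open>t S\<close>\<close>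
    let ?d1 = "\<lambda>k. if k = 0 then 0 else diffs c (k - 1)"
    let ?d2 = "\<lambda>k. if k = 0 then 0 else ?d1 (k - 1)"
    let ?c1 = "\<lambda>k. if k = 0 then 0 else c (k - 1)"
    have L: "(\<lambda>k. A * (diffs c k * t ^ k) - 2 * b * (?d1 k * t ^ k) + ?d2 k * t ^ k)
       sums (A * S' t - 2 * b * (t * S' t) + t * (t * S' t))"
      by (intro sums_add sums_diff sums_mult 1 2 3)
    have R: "(\<lambda>k. 3 * b * (c k * t ^ k) - 3 * (?c1 k * t ^ k))
       sums (3 * b * S t - 3 * (t * S t))"
      by (intro sums_diff sums_mult 0 4)
    have rec: "A * diffs c k - 2 * b * ?d1 k + ?d2 k = 3 * b * c k - 3 * ?c1 k" for k
    proof (cases k rule: nat.exhaust)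
      case zero: zero
      then show ?thesis using A by (simp add: diffs_def c_def)
    next
      case (Suc l)
      have nz: "(real l + 2) * A \<noteq> 0" using A by simp
      have "c (Suc (Suc l)) =
          ((2 * real l + 5) * b * c (Suc l) - (real l + 3) * c l) / ((real l + 2) * A)"
        by (simp add: c_def)
      then have step: "A * ((real l + 2) * c (Suc (Suc l)))
          = (2 * real l + 5) * b * c (Suc l) - (real l + 3) * c l"
        unfolding nonzero_eq_divide_eq[OF nz] by (simp only: mult_ac)
      have d0: "diffs c k = (real l + 2) * c (Suc (Suc l))"
        using Suc by (simp add: diffs_def)
      have d1: "?d1 k = (real l + 1) * c (Suc l)"
        using Suc by (simp add: diffs_def)
      have d2: "?d2 k = real l * c l"
        using Suc by (cases l) (simp_all add: diffs_def)
      have c1: "c k = c (Suc l)" "?c1 k = c l"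
        using Suc by simp_all
      show ?thesis
        unfolding d0 d1 d2 c1 step by (simp add: algebra_simps)
    qed
    have "A * (diffs c k * t ^ k) - 2 * b * (?d1 k * t ^ k) + ?d2 k * t ^ k
        = 3 * b * (c k * t ^ k) - 3 * (?c1 k * t ^ k)" for k
      using arg_cong[OF rec[of k], of "\<lambda>z. z * t ^ k"]
      by (simp add: ring_distribs mult.assoc del: if_split)
    from sums_cong[THEN iffD1, OF this L]
    have "A * S' t - 2 * b * (t * S' t) + t * (t * S' t) = 3 * b * S t - 3 * (t * S t)"
      by (rule sums_unique2[OF _ R])
    then show ?thesis by (simp add: Q_def algebra_simps power2_eq_square)
  qed
  have Qpos: "Q t > 0" if "\<bar>t\<bar> < 1 / 4" for t
    unfolding Q_def by (rule quadratic_pos[OF A b that])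
  have const: "((\<lambda>t. S t * Q t powr (3 / 2)) has_real_derivative 0) (at t)"
    if t: "\<bar>t\<bar> < 1 / 4" for t
  proof -
    have "(Q has_real_derivative (2 * t - 2 * b)) (at t)"
      unfolding Q_def by (auto intro!: derivative_eq_intros)
    then have "((\<lambda>t. Q t powr (3 / 2)) has_real_derivative
        3 / 2 * Q t powr (3 / 2 - 1) * (2 * t - 2 * b)) (at t)"
      using Qpos[OF t] by (auto intro!: derivative_eq_intros)
    from DERIV_mult[OF deriv[OF t] this]
    have D: "((\<lambda>t. S t * Q t powr (3 / 2)) has_real_derivative
        S' t * Q t powr (3 / 2) + 3 / 2 * Q t powr (3 / 2 - 1) * (2 * t - 2 * b) * S t) (at t)" .
    have "Q t powr (3 / 2) = Q t powr (1 + 1 / 2)" by simp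
    also have "\<dots> = Q t * Q t powr (1 / 2)" using Qpos[OF t] by (subst powr_add) simp
    finally have pow: "Q t powr (3 / 2) = Q t * Q t powr (1 / 2)" .
    have "S' t * (Q t * r) + 3 / 2 * r * (2 * t - 2 * b) * S t
        = r * (Q t * S' t - 3 * (b - t) * S t)" for r
      by algebra
    from this[of "Q t powr (1 / 2)"]
    have "S' t * Q t powr (3 / 2) + 3 / 2 * Q t powr (3 / 2 - 1) * (2 * t - 2 * b) * S t
        = Q t powr (1 / 2) * (Q t * S' t - 3 * (b - t) * S t)"
      by (simp add: pow)
    also have "\<dots> = 0" by (simp add: ode[OF t])
    finally show ?thesis using D by simp
  qed
  let ?I = "{- 1 / 4<..<1 / 4 :: real}"
  have "\<exists>C. \<forall>t\<in>?I. S t * Q t powr (3 / 2) = C"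
  proof (rule has_field_derivative_zero_constant)
    fix t assume "t \<in> ?I"
    then have "\<bar>t\<bar> < 1 / 4" unfolding greaterThanLessThan_iff by linarith
    from const[OF this]
    show "((\<lambda>t. S t * Q t powr (3 / 2)) has_real_derivative 0) (at t within ?I)"
      by (rule has_field_derivative_at_within)
  qed simp
  moreover have "s \<in> ?I" "0 \<in> ?I"
    using s unfolding greaterThanLessThan_iff by linarith+
  ultimately have "S s * Q s powr (3 / 2) = S 0 * Q 0 powr (3 / 2)"
    by metis
  moreover have "S 0 = 1" by (simp add: S_def c_def)
  moreover have "Q 0 = A" by (simp add: Q_def)
  ultimately have "S s = A powr (3 / 2) / Q s powr (3 / 2)"
    using Qpos[OF s] by (simp add: field_simps)
  then show ?thesis
    using summable_sums[OF summ[OF s]] by (simp add: S_def Q_def c_def)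
qed

lemma legendre_generating_function:
  assumes "A \<ge> 1" "\<bar>b\<bar> \<le> 1" "\<bar>s\<bar> < 1 / 4"
  shows "(\<lambda>k. legendre_coeff A b k * s ^ k) sums
           ((b - s) * (A powr (3 / 2) / (A - 2 * b * s + s\<^sup>2) powr (3 / 2)))"
proof -
  note G = gegenbauer_generating_function[OF assms]
  show ?thesis
    using sums_diff[OF sums_mult[OF G, of b] sums_shift_power[OF G]]
    unfolding legendre_coeff_def
    by (simp add: left_diff_distrib diff_divide_distrib mult.assoc del: if_split)
qed

text \<open>If \<open>G\<^sub>n\<close> and \<open>H\<^sub>n = b G\<^sub>n - G\<^sub>n\<^sub>-\<^sub>1\<close> vanish, then two consecutive \<open>G\<^sub>k\<close> vanish.  The
  coefficient \<open>-(k + 3)\<close> of the oldest term of the recurrence is never zero, so the vanishing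
  descends to \<open>G\<^sub>0 = 1\<close>.\<close>

lemma no_common_zero:
  assumes A: "A \<noteq> 0" and zero: "gegenbauer_coeff A b n = 0" "legendre_coeff A b n = 0"
  shows False
proof -
  have "gegenbauer_coeff A b k = 0 \<Longrightarrow> gegenbauer_coeff A b (Suc k) = 0 \<Longrightarrow> False" for k
  proof (induction k)
    case (Suc k)
    have "gegenbauer_coeff A b k = 0" using Suc.prems A by simp
    with Suc show False by blast
  qed simp
  then show False using zero by (cases n) (auto simp: legendre_coeff_def)
qed

text \<open>At \<open>A = b = 1\<close> the generating functions are \<open>(1 - s)\<^bsup>-3\<^esup>\<close> and \<open>(1 - s)\<^bsup>-2\<^esup>\<close>.\<close>

lemma legendre_coeff_on_axis: "legendre_coeff 1 1 k = real k + 1"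
proof -
  have closed: "gegenbauer_coeff 1 1 k = (real k + 1) * (real k + 2) / 2" for k
    by (induction k rule: induct_nat_012) (simp_all add: field_simps)
  show ?thesis
    unfolding legendre_coeff_def closed by (cases k) (simp_all add: field_simps)
qed

lemma tendsto_gegenbauer_coeff:
  assumes "(A \<longlongrightarrow> A0) F" "(b \<longlongrightarrow> b0) F" "A0 \<noteq> 0"
  shows "((\<lambda>m. gegenbauer_coeff (A m) (b m) k) \<longlongrightarrow> gegenbauer_coeff A0 b0 k) F"
proof (induction k rule: induct_nat_012)
  case (ge2 k)
  then show ?case using assms by (auto intro!: tendsto_intros)
qed (use assms in \<open>auto intro!: tendsto_intros\<close>)

lemma tendsto_legendre_coeff:
  assumes "(A \<longlongrightarrow> A0) F" "(b \<longlongrightarrow> b0) F" "A0 \<noteq> 0"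
  shows "((\<lambda>m. legendre_coeff (A m) (b m) k) \<longlongrightarrow> legendre_coeff A0 b0 k) F"
  unfolding legendre_coeff_def
  using tendsto_gegenbauer_coeff[OF assms] assms by (auto intro!: tendsto_intros)

section \<open>Zero sets along a direction\<close>

text \<open>The factor \<open>\<rho>\<close> may be negative, so that both ends of a line belong to the same direction
  \<open>(b0, d0)\<close> and no parity argument is needed.  The bounds on \<open>b\<close> and \<open>d\<close> give the
  coefficients of the power series a common geometric bound; the scalings \<open>\<rho> = p\<close> for slopes and \<open>\<rho> = q\<close> for the
  \<open>y\<close>-axis satisfy them.\<close>

definition escapes_along :: "(real \<times> real) set \<Rightarrow> real \<Rightarrow> real \<Rightarrow> bool" where
  "escapes_along S b0 d0 \<longleftrightarrow> (\<exists>\<rho> b d :: nat \<Rightarrow> real.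
     filterlim (\<lambda>m. \<bar>\<rho> m\<bar>) at_top sequentially \<and> b \<longlonglongrightarrow> b0 \<and> d \<longlonglongrightarrow> d0 \<and>
     eventually (\<lambda>m. (\<rho> m * b m, \<rho> m * d m) \<in> S \<and>
       \<rho> m \<noteq> 0 \<and> \<bar>b m\<bar> \<le> 1 \<and> 1 \<le> (b m)\<^sup>2 + (d m)\<^sup>2) sequentially)"

lemma abs_at_top_nonzero:
  fixes f :: "nat \<Rightarrow> real"
  assumes "filterlim (\<lambda>m. \<bar>f m\<bar>) at_top sequentially"
  shows "eventually (\<lambda>m. f m \<noteq> 0) sequentially"
proof -
  have "eventually (\<lambda>m. \<bar>f m\<bar> > 0) sequentially"
    using assms unfolding filterlim_at_top_dense by blast
  then show ?thesis by eventually_elim simp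
qed

lemma asymptotic_direction_escapes:
  assumes "asymptotic_direction L S"
  shows "(\<exists>\<alpha>. L = slope_line \<alpha> \<and> escapes_along S 1 \<alpha>) \<or> (L = y_axis \<and> escapes_along S 0 1)"
  using assms unfolding asymptotic_direction_def
proof (elim disjE exE conjE)
  fix \<alpha> p q
  assume L: "L = slope_line \<alpha>" and S: "\<forall>m. (p m, q m) \<in> S"
    and p: "filterlim (\<lambda>m. \<bar>p m\<bar>) at_top sequentially"
    and lim: "(\<lambda>m. q m / p m) \<longlonglongrightarrow> \<alpha>"
  have "eventually (\<lambda>m. (p m * 1, p m * (q m / p m)) \<in> S \<and>
       p m \<noteq> 0 \<and> \<bar>1::real\<bar> \<le> 1 \<and> 1 \<le> 1\<^sup>2 + (q m / p m)\<^sup>2) sequentially"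
    using abs_at_top_nonzero[OF p] by eventually_elim (use S in auto)
  then have "escapes_along S 1 \<alpha>"
    unfolding escapes_along_def using p lim
    by (intro exI[of _ p] exI[of _ "\<lambda>_. 1"] exI[of _ "\<lambda>m. q m / p m"]) auto
  with L show ?thesis by blast
next
  fix p q
  assume L: "L = y_axis" and S: "\<forall>m. (p m, q m) \<in> S"
    and q: "filterlim (\<lambda>m. \<bar>q m\<bar>) at_top sequentially"
    and lim: "(\<lambda>m. p m / q m) \<longlonglongrightarrow> 0"
  have "(\<lambda>m. \<bar>p m / q m\<bar>) \<longlonglongrightarrow> \<bar>0\<bar>" by (intro tendsto_intros lim)
  then have "eventually (\<lambda>m. \<bar>p m / q m\<bar> < 1) sequentially"
    by (rule order_tendstoD) simp
  then have "eventually (\<lambda>m. (q m * (p m / q m), q m * 1) \<in> S \<and>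
       q m \<noteq> 0 \<and> \<bar>p m / q m\<bar> \<le> 1 \<and> 1 \<le> (p m / q m)\<^sup>2 + 1\<^sup>2) sequentially"
    using abs_at_top_nonzero[OF q] by eventually_elim (use S in auto)
  then have "escapes_along S 0 1"
    unfolding escapes_along_def using q lim
    by (intro exI[of _ q] exI[of _ "\<lambda>_. 1"] exI[of _ "\<lambda>m. p m / q m"]) auto
  with L show ?thesis by blast
qed

lemma inverse_cube_rescaled:
  fixes \<rho> b d x :: real
  assumes "\<rho> \<noteq> 0"
  shows "((\<rho> * b - x)\<^sup>2 + (\<rho> * d)\<^sup>2) powr (3 / 2) =
    (\<rho>\<^sup>2) powr (3 / 2) * ((b\<^sup>2 + d\<^sup>2) - 2 * b * (1 / \<rho> * x) + (1 / \<rho> * x)\<^sup>2) powr (3 / 2)"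
proof -
  have e: "(b\<^sup>2 + d\<^sup>2) - 2 * b * (1 / \<rho> * x) + (1 / \<rho> * x)\<^sup>2 = (b - 1 / \<rho> * x)\<^sup>2 + d\<^sup>2"
    by (simp add: algebra_simps power2_eq_square)
  have "\<rho> * b - x = \<rho> * (b - 1 / \<rho> * x)" using assms by (simp add: field_simps)
  then have "(\<rho> * b - x)\<^sup>2 + (\<rho> * d)\<^sup>2 = \<rho>\<^sup>2 * ((b - 1 / \<rho> * x)\<^sup>2 + d\<^sup>2)"
    by (simp only: power_mult_distrib distrib_left)
  then show ?thesis unfolding e by (simp add: powr_mult)
qed

text \<open>From here on \<open>n\<close> is the order of the first nonzero moment.\<close>

context
  fixes M :: nat and a x :: "nat \<Rightarrow> real" and n :: nat
  assumes low: "\<And>k. k < n \<Longrightarrow> (\<Sum>j = 1..M. a j * x j ^ k) = 0"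
    and top: "(\<Sum>j = 1..M. a j * x j ^ n) \<noteq> 0"
begin

text \<open>The common part of the arguments for \<open>X\<close> and \<open>Y\<close>: the weight \<open>w\<close> is the identity for \<open>X\<close>
  and constantly \<open>1\<close> for \<open>Y\<close>.  The vanishing in \<open>zero\<close> may use \<open>d \<noteq> 0\<close> in directions other
  than the \<open>x\<close>-axis, which allows the factor \<open>d\<close> of \<open>Y\<close> to be cancelled.\<close>

lemma leading_coefficient_zero_of_escape:
  fixes S :: "(real \<times> real) set" and coeff :: "real \<Rightarrow> real \<Rightarrow> nat \<Rightarrow> real" and w :: "real \<Rightarrow> real"
  assumes escapes: "escapes_along S b0 d0"
    and bound: "\<And>A b k. A \<ge> 1 \<Longrightarrow> \<bar>b\<bar> \<le> 1 \<Longrightarrow> \<bar>coeff A b k\<bar> \<le> 2 * 4 ^ k"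
    and lim: "\<And>A b. A \<longlonglongrightarrow> b0\<^sup>2 + d0\<^sup>2 \<Longrightarrow> b \<longlonglongrightarrow> b0 \<Longrightarrow>
       (\<lambda>m. coeff (A m) (b m) n) \<longlonglongrightarrow> coeff (b0\<^sup>2 + d0\<^sup>2) b0 n"
    and series: "\<And>A b s. A \<ge> 1 \<Longrightarrow> \<bar>b\<bar> \<le> 1 \<Longrightarrow> \<bar>s\<bar> < 1 / 4 \<Longrightarrow>
       (\<lambda>k. coeff A b k * s ^ k) sums
         (w (b - s) * (A powr (3 / 2) / (A - 2 * b * s + s\<^sup>2) powr (3 / 2)))"
    and zero: "\<And>\<rho> b d. \<rho> \<noteq> 0 \<Longrightarrow> (d0 \<noteq> 0 \<longrightarrow> d \<noteq> 0) \<Longrightarrow> (\<rho> * b, \<rho> * d) \<in> S \<Longrightarrow>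
       (\<Sum>j = 1..M. a j * w (b - 1 / \<rho> * x j) / ((\<rho> * b - x j)\<^sup>2 + (\<rho> * d)\<^sup>2) powr (3 / 2)) = 0"
  shows "coeff (b0\<^sup>2 + d0\<^sup>2) b0 n = 0"
proof -
  obtain \<rho> b d :: "nat \<Rightarrow> real"
    where \<rho>: "filterlim (\<lambda>m. \<bar>\<rho> m\<bar>) at_top sequentially"
      and b: "b \<longlonglongrightarrow> b0" and d: "d \<longlonglongrightarrow> d0"
      and ev: "eventually (\<lambda>m. (\<rho> m * b m, \<rho> m * d m) \<in> S \<and>
         \<rho> m \<noteq> 0 \<and> \<bar>b m\<bar> \<le> 1 \<and> 1 \<le> (b m)\<^sup>2 + (d m)\<^sup>2) sequentially"
    using escapes unfolding escapes_along_def by blast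
  define h where "h = (\<lambda>m. 1 / \<rho> m)"
  define A where "A = (\<lambda>m. (b m)\<^sup>2 + (d m)\<^sup>2)"
  have A: "A \<longlonglongrightarrow> b0\<^sup>2 + d0\<^sup>2" unfolding A_def by (intro tendsto_intros b d)
  have "filterlim \<rho> at_infinity sequentially"
    using \<rho> by (auto simp: filterlim_at_infinity_conv_norm_at_top)
  then have h: "h \<longlonglongrightarrow> 0"
    unfolding h_def by (intro tendsto_divide_0[OF tendsto_const])
  have d_ev: "eventually (\<lambda>m. d0 \<noteq> 0 \<longrightarrow> d m \<noteq> 0) sequentially"
  proof (cases "d0 = 0")
    case False
    from tendsto_imp_eventually_ne[OF d this] show ?thesis by eventually_elim simp
  qed simp
  have small: "eventually (\<lambda>m. \<forall>j\<in>{1..M}. \<bar>h m * x j\<bar> < 1 / 4) sequentially"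
  proof (intro eventually_ball_finite ballI)
    fix j
    have "(\<lambda>m. \<bar>h m * x j\<bar>) \<longlonglongrightarrow> \<bar>0 * x j\<bar>" by (intro tendsto_intros h)
    then show "eventually (\<lambda>m. \<bar>h m * x j\<bar> < 1 / 4) sequentially"
      by (rule order_tendstoD) simp
  qed simp
  show ?thesis
  proof (rule leading_coefficient_vanishes[where J = "{1..M}" and h = h and K = 4 and C = 2
        and g = "\<lambda>m. coeff (A m) (b m)" and a = a and x = x and n = n])
    show "eventually (\<lambda>m. h m \<noteq> 0) sequentially"
      using ev by eventually_elim (simp add: h_def)
    show "eventually (\<lambda>m. \<forall>k. \<bar>coeff (A m) (b m) k\<bar> \<le> 2 * 4 ^ k) sequentially"
      using ev by eventually_elim (simp add: A_def bound)
    show "eventually (\<lambda>m. (\<Sum>j = 1..M. a j * (\<Sum>k. coeff (A m) (b m) k * (h m * x j) ^ k)) = 0)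
        sequentially"
      using ev d_ev small
    proof eventually_elim
      case (elim m)
      define c where "c = A m powr (3 / 2) * ((\<rho> m)\<^sup>2) powr (3 / 2)"
      have "a j * (\<Sum>k. coeff (A m) (b m) k * (h m * x j) ^ k) =
          c * (a j * w (b m - 1 / \<rho> m * x j) /
            ((\<rho> m * b m - x j)\<^sup>2 + (\<rho> m * d m)\<^sup>2) powr (3 / 2))" if "j \<in> {1..M}" for j
      proof -
        have "(\<Sum>k. coeff (A m) (b m) k * (h m * x j) ^ k) =
          w (b m - h m * x j) * (A m powr (3 / 2) /
            (A m - 2 * b m * (h m * x j) + (h m * x j)\<^sup>2) powr (3 / 2))"
          using elim that by (intro sums_unique[symmetric] series) (auto simp: A_def)
        moreover have "((\<rho> m)\<^sup>2) powr (3 / 2) \<noteq> 0" using elim by simp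
        ultimately show ?thesis
          using elim by (simp add: inverse_cube_rescaled c_def A_def h_def)
      qed
      then have "(\<Sum>j = 1..M. a j * (\<Sum>k. coeff (A m) (b m) k * (h m * x j) ^ k)) =
        c * (\<Sum>j = 1..M. a j * w (b m - 1 / \<rho> m * x j) /
            ((\<rho> m * b m - x j)\<^sup>2 + (\<rho> m * d m)\<^sup>2) powr (3 / 2))"
        by (simp add: sum_distrib_left)
      also have "\<dots> = 0" using elim zero[of "\<rho> m" "d m" "b m"] by simp
      finally show ?case .
    qed
    show "(\<lambda>m. coeff (A m) (b m) n) \<longlonglongrightarrow> coeff (b0\<^sup>2 + d0\<^sup>2) b0 n" by (rule lim[OF A b])
  qed (use h low top in auto)
qed

lemma zero_set_X_direction:
  assumes A0: "b0\<^sup>2 + d0\<^sup>2 \<noteq> 0" and "escapes_along (zero_set_X M a x) b0 d0"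
  shows "legendre_coeff (b0\<^sup>2 + d0\<^sup>2) b0 n = 0"
proof (rule leading_coefficient_zero_of_escape[where w = "\<lambda>z. z", OF assms(2)])
  fix \<rho> b d :: real
  assume \<rho>: "\<rho> \<noteq> 0" and S: "(\<rho> * b, \<rho> * d) \<in> zero_set_X M a x"
  have "\<rho> * (\<Sum>j = 1..M. a j * (b - 1 / \<rho> * x j) / ((\<rho> * b - x j)\<^sup>2 + (\<rho> * d)\<^sup>2) powr (3 / 2))
      = field_X M a x (\<rho> * b) (\<rho> * d)"
    unfolding field_X_def sum_distrib_left
  proof (intro sum.cong refl)
    fix j
    have "\<rho> * (b - 1 / \<rho> * x j) = \<rho> * b - x j" using \<rho> by (simp add: field_simps)
    then show "\<rho> * (a j * (b - 1 / \<rho> * x j) / ((\<rho> * b - x j)\<^sup>2 + (\<rho> * d)\<^sup>2) powr (3 / 2))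
        = a j * (\<rho> * b - x j) / ((\<rho> * b - x j)\<^sup>2 + (\<rho> * d)\<^sup>2) powr (3 / 2)"
      by (simp only: times_divide_eq_right mult.left_commute[of \<rho>])
  qed
  then show "(\<Sum>j = 1..M. a j * (b - 1 / \<rho> * x j) / ((\<rho> * b - x j)\<^sup>2 + (\<rho> * d)\<^sup>2) powr (3 / 2)) = 0"
    using S \<rho> by (simp add: zero_set_X_def)
qed (erule legendre_coeff_bound, assumption, erule tendsto_legendre_coeff, assumption, rule A0,
    rule legendre_generating_function)

lemma zero_set_Y_direction:
  assumes d0: "d0 \<noteq> 0" and "escapes_along (zero_set_Y M a x) b0 d0"
  shows "gegenbauer_coeff (b0\<^sup>2 + d0\<^sup>2) b0 n = 0"
proof -
  have A0: "b0\<^sup>2 + d0\<^sup>2 \<noteq> 0" using d0 by simp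
  show ?thesis
  proof (rule leading_coefficient_zero_of_escape[where w = "\<lambda>_. 1", OF assms(2)])
    fix \<rho> b d :: real
    assume \<rho>: "\<rho> \<noteq> 0" and d: "d0 \<noteq> 0 \<longrightarrow> d \<noteq> 0" and S: "(\<rho> * b, \<rho> * d) \<in> zero_set_Y M a x"
    have "\<rho> * d * (\<Sum>j = 1..M. a j * 1 / ((\<rho> * b - x j)\<^sup>2 + (\<rho> * d)\<^sup>2) powr (3 / 2))
        = field_Y M a x (\<rho> * b) (\<rho> * d)"
      unfolding field_Y_def sum_distrib_left
      by (intro sum.cong refl) (simp add: mult_ac)
    then show "(\<Sum>j = 1..M. a j * 1 / ((\<rho> * b - x j)\<^sup>2 + (\<rho> * d)\<^sup>2) powr (3 / 2)) = 0"
      using S \<rho> d d0 by (simp add: zero_set_Y_def)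
  next
    fix A b :: real and k
    assume "A \<ge> 1" "\<bar>b\<bar> \<le> 1"
    from gegenbauer_coeff_bound[OF this, of k] show "\<bar>gegenbauer_coeff A b k\<bar> \<le> 2 * 4 ^ k"
      using zero_le_power[of "4::real" k] by linarith
  next
    fix A b s :: real
    assume "A \<ge> 1" "\<bar>b\<bar> \<le> 1" "\<bar>s\<bar> < 1 / 4"
    from gegenbauer_generating_function[OF this]
    show "(\<lambda>k. gegenbauer_coeff A b k * s ^ k) sums
        (1 * (A powr (3 / 2) / (A - 2 * b * s + s\<^sup>2) powr (3 / 2)))" by simp
  qed (rule tendsto_gegenbauer_coeff[OF _ _ A0])
qed

text \<open>The \<open>x\<close>-axis is separate because every point of it off the charges is a zero of \<open>Y\<close>; there the
  zeros of \<open>X\<close> alone give the contradiction.\<close>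

lemma no_common_direction:
  assumes "escapes_along (zero_set_X M a x) b0 d0" "escapes_along (zero_set_Y M a x) b0 d0"
    and "d0 \<noteq> 0 \<or> b0 = 1"
  shows False
proof (cases "d0 = 0")
  case True
  then have "legendre_coeff 1 1 n = 0" using zero_set_X_direction[of b0 d0] assms by simp
  then show False by (simp add: legendre_coeff_on_axis)
next
  case False
  then have "b0\<^sup>2 + d0\<^sup>2 \<noteq> 0" by simp
  then show False
    using no_common_zero zero_set_X_direction zero_set_Y_direction assms(1,2) False by blast
qed

end

section \<open>Lines as asymptotic directions\<close>

lemma slope_line_eq_iff: "slope_line \<alpha> = slope_line \<beta> \<longleftrightarrow> \<alpha> = \<beta>"
proof
  assume "slope_line \<alpha> = slope_line \<beta>"
  moreover have "(1, \<alpha>) \<in> slope_line \<alpha>" by (simp add: slope_line_def)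
  ultimately show "\<alpha> = \<beta>" by (simp add: slope_line_def)
qed simp

lemma slope_line_neq_y_axis: "slope_line \<alpha> \<noteq> y_axis"
proof
  assume "slope_line \<alpha> = y_axis"
  moreover have "(1, \<alpha>) \<in> slope_line \<alpha>" by (simp add: slope_line_def)
  ultimately show False by (simp add: y_axis_def)
qed

theorem proposition2p9:
  fixes M :: nat and a x :: "nat \<Rightarrow> real"
  assumes "M \<ge> 1"
    and "0 < x 1"
    and "strict_mono_on {1..M} x"
    and "\<exists>j\<in>{1..M}. a j \<noteq> 0"
  shows "\<forall>L. L \<noteq> slope_line 1 \<and> L \<noteq> slope_line (- 1) \<longrightarrow>
           \<not> (asymptotic_direction L (zero_set_X M a x) \<and>
              asymptotic_direction L (zero_set_Y M a x))"
proof -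
  have "\<exists>k. (\<Sum>j = 1..M. a j * x j ^ k) \<noteq> 0"
    using assms some_moment_nonzero[of "{1..M}" x] strict_mono_on_imp_inj_on by blast
  then obtain n where top: "(\<Sum>j = 1..M. a j * x j ^ n) \<noteq> 0"
      and low: "\<And>k. k < n \<Longrightarrow> (\<Sum>j = 1..M. a j * x j ^ k) = 0"
    using exists_least_iff[of "\<lambda>k. (\<Sum>j = 1..M. a j * x j ^ k) \<noteq> 0"] by blast
  have False if "asymptotic_direction L (zero_set_X M a x)"
      "asymptotic_direction L (zero_set_Y M a x)" for L
  proof -
    note clash = no_common_direction[where n = n and M = M and a = a and x = x, OF low top]
    from asymptotic_direction_escapes[OF that(1)] show False
    proof (elim disjE exE conjE)
      fix \<alpha>
      assume "L = slope_line \<alpha>" "escapes_along (zero_set_X M a x) 1 \<alpha>"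
      moreover from this asymptotic_direction_escapes[OF that(2)]
      have "escapes_along (zero_set_Y M a x) 1 \<alpha>"
        by (auto simp: slope_line_eq_iff slope_line_neq_y_axis)
      ultimately show False using clash[of 1 \<alpha>] by simp
    next
      assume "L = y_axis" "escapes_along (zero_set_X M a x) 0 1"
      moreover from this asymptotic_direction_escapes[OF that(2)]
      have "escapes_along (zero_set_Y M a x) 0 1"
        by (auto simp: slope_line_neq_y_axis[symmetric])
      ultimately show False using clash[of 0 1] by simp
    qed
  qed
  then show ?thesis by blast
qed

end
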